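(* Let $g:\mathbb{R}^n\to\mathbb{R}\cup\{+\infty\}$ be a closed proper convex function that is positively homogeneous of degree $d$, where $1<d\in\mathbb{R}$, and let $G:=\{\mathbf{x}:g(\mathbf{x})\le 1/d\}$. Let $q$ be defined by $\frac1d+\frac1q=1$. Then $$G^\circ=\{\mathbf{x}\in\mathbb{R}^n: g^*(\mathbf{x})\le 1/q\},$$ where $g^*$ is the Legendre-Fenchel conjugate of $g$; in other words, $G^\circ$ is a sublevel set of the function $g^*$, which is positively homogeneous of degree $q$. Moreover, if $G$ is bounded then $$\mathrm{vol}(G^\circ)=\frac{1}{q^{n/q}\,\Gamma(1+n/q)}\int_{\mathbb{R}^n}\exp(-g^* )\,d\mathbf{x}.$$
   Context: A convex function $f$ is proper if $f(\mathbf{x})>-\infty$ for all $\mathbf{x}$ and $f(\mathbf{x})<+\infty$ for some $\mathbf{x}$; a proper convex function is closed if it is lower semicontinuous. Positive homogeneity of degree $d$ means $g(\lambda\mathbf{x})=\lambda^d g(\mathbf{x})$ for all $\lambda>0$ and all $\mathbf{x}$. The polar of $C\subset\mathbb{R}^n$ is $C^\circ=\{\mathbf{x}:\sigma_C(\mathbf{x})\le 1\}$ with $\sigma_C(\mathbf{x})=\sup\{\langle\mathbf{x},\mathbf{y}\rangle:\mathbf{y}\in C\}$. The Legendre-Fenchel conjugate is $g^*(\mathbf{u})=\sup_{\mathbf{x}}\{\langle\mathbf{u},\mathbf{x}\rangle-g(\mathbf{x})\}$. $\mathrm{vol}$ is Lebesgue measure (values in $[0,+\infty]$); $\Gamma$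 is the Gamma function. *)

theory Defs
  imports "HOL-Analysis.Analysis"
begin

(* Functions R^n -> [-infinity, +infinity] have type 'a => ereal. Convexity is convexity of the
   epigraph; the library constants convex_on and epigraph only cover real-valued functions. *)
definition convex_ereal :: "('a::real_vector \<Rightarrow> ereal) \<Rightarrow> bool" where
  "convex_ereal f \<longleftrightarrow> convex {(x, r::real). f x \<le> ereal r}"

definition proper_ereal :: "('a \<Rightarrow> ereal) \<Rightarrow> bool" where
  "proper_ereal f \<longleftrightarrow> (\<forall>x. f x > -\<infinity>) \<and> (\<exists>x. f x < \<infinity>)"

definition lower_semicontinuous :: "('a::topological_space \<Rightarrow> ereal) \<Rightarrow> bool" where
  "lower_semicontinuous f \<longleftrightarrow> (\<forall>x. f x \<le> Liminf (at x) f)"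

definition closed_proper_convex :: "('a::real_normed_vector \<Rightarrow> ereal) \<Rightarrow> bool" where
  "closed_proper_convex f \<longleftrightarrow> convex_ereal f \<and> proper_ereal f \<and> lower_semicontinuous f"

definition pos_homogeneous :: "real \<Rightarrow> ('a::real_vector \<Rightarrow> ereal) \<Rightarrow> bool" where
  "pos_homogeneous d f \<longleftrightarrow> (\<forall>l>0. \<forall>x. f (l *\<^sub>R x) = ereal (l powr d) * f x)"

definition support_fun :: "'a::real_inner set \<Rightarrow> 'a \<Rightarrow> ereal" where
  "support_fun C x = (SUP y\<in>C. ereal (x \<bullet> y))"

definition polar :: "'a::real_inner set \<Rightarrow> 'a set" where
  "polar C = {x. support_fun C x \<le> 1}"

definition conjugate :: "('a::real_inner \<Rightarrow> ereal) \<Rightarrow> 'a \<Rightarrow> ereal" where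
  "conjugate g u = (SUP x. ereal (u \<bullet> x) - g x)"

(* The exponential on [-infinity, +infinity], with exp(-infinity) = 0 and
   exp(+infinity) = +infinity. *)
fun exp_ereal :: "ereal \<Rightarrow> ennreal" where
  "exp_ereal (ereal r) = ennreal (exp r)"
| "exp_ereal PInfty = \<infinity>"
| "exp_ereal MInfty = 0"

end

theory Submission
  imports Defs
begin

text \<open>
  Fenchel's inequality gives one inclusion for the polar; for the other, rescale \<open>x\<close> to the
  boundary of \<open>G\<close> by \<open>\<lambda> = (d g(x))\<^bsup>1/d\<^esup>\<close> and apply Young's inequality
  \<open>\<lambda> \<le> \<lambda>\<^sup>d/d + 1/q\<close>. For the volume, write
  \<open>exp (- g\<^sup>*(x))\<close> as the integral of \<open>exp (- t)\<close> over \<open>t \<ge> g\<^sup>*(x)\<close>, exchange the integrals, and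
  use that the volume of \<open>{g\<^sup>* \<le> t}\<close> is \<open>t\<^bsup>n/q\<^esup>\<close> times that of \<open>{g\<^sup>* \<le> 1}\<close>.
\<close>

section \<open>Homogeneous convex functions: value at the origin and sign\<close>

lemma pos_homogeneousD:
  assumes "pos_homogeneous d f" "l > 0"
  shows "f (l *\<^sub>R x) = ereal (l powr d) * f x"
  using assms by (simp add: pos_homogeneous_def)

lemma convex_erealD:
  assumes "convex_ereal f" "f x \<le> ereal a" "f y \<le> ereal b" "0 \<le> u" "u \<le> 1"
  shows "f ((1 - u) *\<^sub>R x + u *\<^sub>R y) \<le> ereal ((1 - u) * a + u * b)"
  using convexD_alt[of "{(x, r). f x \<le> ereal r}" "(x, a)" "(y, b)" u] assms
  by (simp add: convex_ereal_def)

text \<open>Along the ray through a point of finite value \<open>a\<close>, the values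
  \<open>l powr d * a\<close> stay below \<open>\<bar>a\<bar>\<close> in absolute value for
  \<open>l \<le> 1\<close>, so lower semicontinuity at the origin rules out
  \<open>f 0 = \<infinity>\<close>. A finite value at the origin equals its own multiple by
  \<open>2 powr d > 1\<close>, hence vanishes.\<close>

lemma pos_homogeneous_zero:
  fixes f :: "'a::real_normed_vector \<Rightarrow> ereal"
  assumes f: "proper_ereal f" "lower_semicontinuous f" and hom: "pos_homogeneous d f"
    and d: "d > 0"
  shows "f 0 = 0"
proof -
  have "\<bar>f 0\<bar> \<noteq> \<infinity>"
  proof
    assume "\<bar>f 0\<bar> = \<infinity>"
    with f(1) have inf: "f 0 = \<infinity>" by (auto simp: proper_ereal_def)
    from f(1) obtain x where "f x < \<infinity>" "f x > -\<infinity>"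
      by (auto simp: proper_ereal_def)
    then obtain a where a: "f x = ereal a" by (cases "f x") auto
    have x: "x \<noteq> 0" using a inf by auto
    have "f 0 \<le> Liminf (at 0) f"
      using f(2) by (simp add: lower_semicontinuous_def)
    hence "eventually (\<lambda>y. ereal \<bar>a\<bar> < f y) (at 0)"
      by (simp add: inf le_Liminf_iff)
    then obtain e where e: "e > 0" "\<And>y. y \<noteq> 0 \<Longrightarrow> dist y 0 < e \<Longrightarrow> ereal \<bar>a\<bar> < f y"
      by (auto simp: eventually_at)
    \<comment> \<open>The bound 1 yields \<open>l powr d \<le> 1\<close>; the factor 2 puts
      \<open>l *\<^sub>R x\<close> strictly inside the ball of radius \<open>e\<close>.\<close>
    define l where "l = min 1 (e / (2 * norm x))"
    have l: "l > 0" "l \<le> 1" using e x by (auto simp: l_def)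
    have "l * norm x \<le> e / (2 * norm x) * norm x"
      by (intro mult_right_mono) (auto simp: l_def)
    also have "\<dots> < e" using x e by simp
    finally have "ereal \<bar>a\<bar> < f (l *\<^sub>R x)"
      using l x by (intro e) auto
    also have "\<dots> = ereal (l powr d * a)"
      using pos_homogeneousD[OF hom l(1)] by (simp add: a)
    finally have "\<bar>a\<bar> < l powr d * a" by simp
    moreover have "l powr d * a \<le> l powr d * \<bar>a\<bar>"
      by (intro mult_left_mono) auto
    moreover have "l powr d * \<bar>a\<bar> \<le> 1 * \<bar>a\<bar>"
      using l d by (intro mult_right_mono powr_le1) auto
    ultimately show False by simp
  qed
  then obtain b where b: "f 0 = ereal b" by (cases "f 0") auto
  have "f 0 = ereal (2 powr d) * f 0"
    using pos_homogeneousD[OF hom, of 2 0] by simp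
  hence "b = 2 powr d * b" by (simp add: b)
  moreover have "(2::real) powr d > 1" using d by simp
  ultimately show ?thesis using d by (simp add: b)
qed

text \<open>Since \<open>x\<close> is the midpoint of 0 and \<open>2 *\<^sub>R x\<close>, convexity
  gives \<open>2 * f x \<le> 2 powr d * f x\<close>. This fails for negative \<open>f x\<close>,
  because \<open>d > 1\<close> makes \<open>2 powr d\<close> exceed 2.\<close>

lemma pos_homogeneous_convex_nonneg:
  fixes f :: "'a::real_normed_vector \<Rightarrow> ereal"
  assumes f: "proper_ereal f" "convex_ereal f" and hom: "pos_homogeneous d f"
    and d: "d > 1" and zero: "f 0 = 0"
  shows "f x \<ge> 0"
proof (rule ccontr)
  assume "\<not> f x \<ge> 0"
  moreover have "f x > -\<infinity>" using f by (simp add: proper_ereal_def)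
  ultimately obtain a where a: "f x = ereal a" "a < 0" by (cases "f x") auto
  have "f (2 *\<^sub>R x) = ereal (2 powr d * a)"
    using pos_homogeneousD[OF hom, of 2 x] by (simp add: a)
  hence "f ((1 - 1/2) *\<^sub>R 0 + (1/2) *\<^sub>R (2 *\<^sub>R x)) \<le> ereal ((1 - 1/2) * 0 + (1/2) * (2 powr d * a))"
    using f zero by (intro convex_erealD) auto
  hence "2 * a \<le> 2 powr d * a" by (simp add: a)
  moreover have "(2::real) powr d > 2 powr 1" using d by (intro powr_less_mono) auto
  ultimately show False using a by simp
qed

section \<open>Conjugates and the polar of a sublevel set\<close>

lemma Fenchel_inequality:
  fixes f :: "'a::real_inner \<Rightarrow> ereal"
  shows "ereal (u \<bullet> x) - f x \<le> conjugate f u"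
  by (auto simp: conjugate_def intro: SUP_upper)

lemma conjugate_nonneg:
  assumes "f 0 = 0"
  shows "conjugate f u \<ge> 0"
  using Fenchel_inequality[of u 0 f] assms by (simp add: zero_ereal_def)

text \<open>Substituting \<open>x = (l powr (q - 1)) *\<^sub>R y\<close> in the supremum pulls the
  same factor \<open>l powr q\<close> out of both the inner product and \<open>f x\<close>, because
  \<open>(q - 1) * d = q\<close>.\<close>

lemma pos_homogeneous_conjugate:
  fixes f :: "'a::real_inner \<Rightarrow> ereal"
  assumes hom: "pos_homogeneous d f" and d: "d > 1" and dq: "1 / d + 1 / q = 1"
  shows "pos_homogeneous q (conjugate f)"
proof -
  have q: "q \<noteq> 0" using d dq by auto
  have qd: "(q - 1) * d = q" using d dq q by (simp add: field_simps)
  have le: "conjugate f (l *\<^sub>R u) \<le> ereal (l powr q) * conjugate f u" if l: "l > 0" for l u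
    unfolding conjugate_def[of f "l *\<^sub>R u"]
  proof (rule SUP_least)
    fix x :: 'a
    define y where "y = (l powr (1 - q)) *\<^sub>R x"
    have x: "x = (l powr (q - 1)) *\<^sub>R y"
      using l by (simp add: y_def flip: powr_add)
    have "f x = ereal (l powr q) * f y"
      using pos_homogeneousD[OF hom, of "l powr (q - 1)" y] l by (simp add: powr_powr qd flip: x)
    moreover have "l *\<^sub>R u \<bullet> x = l powr q * (u \<bullet> y)"
    proof -
      have "l powr q = l * l powr (q - 1)"
        using l by (simp add: powr_diff)
      thus ?thesis using l by (simp add: x)
    qed
    ultimately have "ereal (l *\<^sub>R u \<bullet> x) - f x = ereal (l powr q) * (ereal (u \<bullet> y) - f y)"
      using l by (cases "f y") (auto simp: algebra_simps)
    also have "\<dots> \<le> ereal (l powr q) * conjugate f u"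
      by (intro ereal_mult_left_mono Fenchel_inequality) auto
    finally show "ereal (l *\<^sub>R u \<bullet> x) - f x \<le> ereal (l powr q) * conjugate f u" .
  qed
  show ?thesis
    unfolding pos_homogeneous_def
  proof (intro allI impI antisym le)
    fix l :: real and u
    assume l: "l > 0"
    \<comment> \<open>The reverse inequality is \<open>le\<close> again, for the factor
      \<open>1 / l\<close> at the point \<open>l *\<^sub>R u\<close>.\<close>
    have "ereal (l powr q) * conjugate f u
        = ereal (l powr q) * conjugate f ((1 / l) *\<^sub>R l *\<^sub>R u)"
      using l by simp
    also have "\<dots> \<le> ereal (l powr q) * (ereal ((1 / l) powr q) * conjugate f (l *\<^sub>R u))"
      using l by (intro ereal_mult_left_mono le) auto
    also have "\<dots> = conjugate f (l *\<^sub>R u)"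
      using l by (simp add: powr_divide flip: mult.assoc)
    finally show "ereal (l powr q) * conjugate f u \<le> conjugate f (l *\<^sub>R u)" .
  qed
qed

text \<open>The two levels are matched to the inequalities: Fenchel's bounds
  \<open>u \<bullet> x\<close> by \<open>1 / d + 1 / q = 1\<close>, and Young's with second factor 1
  leaves the constant \<open>1 / q\<close>.\<close>

lemma polar_sublevel_eq:
  fixes g :: "'a::real_inner \<Rightarrow> ereal"
  assumes hom: "pos_homogeneous d g" and nonneg: "\<And>x. g x \<ge> 0"
    and d: "d > 1" and dq: "1 / d + 1 / q = 1"
  shows "polar {x. g x \<le> ereal (1 / d)} = {u. conjugate g u \<le> ereal (1 / q)}"
proof (intro set_eqI iffI; simp only: mem_Collect_eq)
  fix u assume u: "conjugate g u \<le> ereal (1 / q)"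
  have "u \<bullet> x \<le> 1" if x: "g x \<le> ereal (1 / d)" for x
  proof -
    obtain r where r: "g x = ereal r" using x nonneg[of x] by (cases "g x") auto
    have "ereal (u \<bullet> x - r) \<le> ereal (1 / q)"
      using order_trans[OF Fenchel_inequality u, of x] by (simp add: r)
    thus ?thesis using x dq by (simp add: r)
  qed
  thus "u \<in> polar {x. g x \<le> ereal (1 / d)}"
    by (auto simp: polar_def support_fun_def intro!: SUP_least)
next
  fix u assume u: "u \<in> polar {x. g x \<le> ereal (1 / d)}"
  have le: "u \<bullet> x \<le> 1" if "g x \<le> ereal (1 / d)" for x
  proof -
    have "ereal (u \<bullet> x) \<le> support_fun {x. g x \<le> ereal (1 / d)} u"
      unfolding support_fun_def using that by (intro SUP_upper) auto
    also have "\<dots> \<le> 1" using u by (simp add: polar_def)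
    finally show ?thesis by simp
  qed
  have "1 / d < 1" using d by simp
  hence "1 / q > 0" using dq by linarith
  hence q: "q > 0" by simp
  have "q > 1"
  proof -
    have "1 / d > 0" using d by simp
    hence "1 / q < 1" using dq by linarith
    thus ?thesis using q by simp
  qed
  show "conjugate g u \<le> ereal (1 / q)"
    unfolding conjugate_def
  proof (rule SUP_least)
    fix x
    consider "g x = \<infinity>" | "g x = 0" | r where "g x = ereal r" "r > 0"
      using nonneg[of x] by (cases "g x") (auto simp: zero_ereal_def order.order_iff_strict)
    thus "ereal (u \<bullet> x) - g x \<le> ereal (1 / q)"
    proof cases
      case 2
      \<comment> \<open>No rescaling reaches the boundary here: every positive multiple of
        \<open>x\<close> lies in the sublevel set. The multiple \<open>2 * q\<close> already
        suffices, as its inner product with \<open>u\<close> would exceed 2.\<close>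
      have "u \<bullet> x \<le> 1 / q"
      proof (rule ccontr)
        assume *: "\<not> u \<bullet> x \<le> 1 / q"
        have "g ((2 * q) *\<^sub>R x) = 0"
          using pos_homogeneousD[OF hom, of "2 * q" x] q 2 by simp
        hence "u \<bullet> ((2 * q) *\<^sub>R x) \<le> 1" using d by (intro le) auto
        with * q show False by (simp add: field_simps)
      qed
      thus ?thesis using 2 by simp
    next
      case (3 r)
      define l where "l = (d * r) powr (1 / d)"
      have l: "l > 0" using 3 d by (simp add: l_def)
      have ld: "l powr d = d * r" using 3 d by (simp add: l_def powr_powr)
      have "g ((1 / l) *\<^sub>R x) = ereal (1 / d)"
        using pos_homogeneousD[OF hom, of "1 / l" x] l 3 d by (simp add: powr_divide ld)
      hence "u \<bullet> ((1 / l) *\<^sub>R x) \<le> 1" by (intro le) auto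
      hence "u \<bullet> x \<le> l" using l by (simp add: field_simps)
      also have "l \<le> l powr d / d + 1 / q"
        using Youngs_inequality[of d q l 1] d dq \<open>q > 1\<close> l by simp
      also have "l powr d / d = r" using ld d by simp
      finally show ?thesis by (simp add: 3)
    qed auto
  qed
qed

section \<open>Measurability, volumes of sublevel sets and the Gamma integral\<close>

lemma borel_measurable_conjugate:
  fixes f :: "'a::real_inner \<Rightarrow> ereal"
  shows "conjugate f \<in> borel_measurable borel"
proof -
  have "closed {u. conjugate f u \<le> a}" for a
  proof -
    \<comment> \<open>Each function in the supremum is affine in \<open>u\<close> when
      \<open>f x\<close> is finite, and constant otherwise.\<close>
    have "closed {u. ereal (u \<bullet> x) - f x \<le> a}" for x
    proof (cases "f x")
      case (real r)
      show ?thesis unfolding real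
        by (intro closed_Collect_le continuous_intros continuous_on_ereal) (simp_all add: continuous_intros)
    qed auto
    hence "closed (\<Inter>x. {u. ereal (u \<bullet> x) - f x \<le> a})" by blast
    also have "(\<Inter>x. {u. ereal (u \<bullet> x) - f x \<le> a}) = {u. conjugate f u \<le> a}"
      by (auto simp: conjugate_def SUP_le_iff)
    finally show ?thesis .
  qed
  thus ?thesis
    by (auto simp: borel_measurable_iff_Iic_ereal vimage_def intro: borel_closed)
qed

text \<open>Dilation by \<open>c powr (1 / q)\<close> maps the sublevel set of level 1 onto that of
  level \<open>c\<close>.\<close>

lemma emeasure_sublevel_pos_homogeneous:
  fixes f :: "'a::euclidean_space \<Rightarrow> ereal"
  assumes f [measurable]: "f \<in> borel_measurable borel" and hom: "pos_homogeneous q f"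
    and q: "q > 0" and c: "c > 0"
  shows "emeasure lborel {x. f x \<le> ereal c} =
    ennreal (c powr (real DIM('a) / q)) * emeasure lborel {x. f x \<le> 1}"
proof -
  define s where "s = c powr (1 / q)"
  have s: "s > 0" and sq: "s powr q = c" using c q by (auto simp: s_def powr_powr)
  have sn: "s ^ DIM('a) = c powr (real DIM('a) / q)"
    using c by (simp add: s_def powr_powr flip: powr_realpow)
  have iff: "f (s *\<^sub>R x) \<le> ereal c \<longleftrightarrow> f x \<le> 1" for x
    using pos_homogeneousD[OF hom s, of x] c by (cases "f x") (auto simp: sq)
  \<comment> \<open>The change of variables: \<open>lborel\<close> is its own image under the
    dilation, with constant density \<open>s ^ DIM('a)\<close>.\<close>
  have "emeasure lborel {x. f x \<le> ereal c} =
      emeasure (density (distr lborel borel (\<lambda>x::'a. 0 + s *\<^sub>R x)) (\<lambda>_. \<bar>s\<bar> ^ DIM('a)))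
        {x. f x \<le> ereal c}"
    using s by (subst lborel_affine[of s 0]) auto
  also have "\<dots> = ennreal (s ^ DIM('a)) *
      emeasure (distr lborel borel (\<lambda>x::'a. 0 + s *\<^sub>R x)) {x. f x \<le> ereal c}"
    using s by (subst emeasure_density) (auto simp: nn_integral_cmult_indicator)
  also have "emeasure (distr lborel borel (\<lambda>x::'a. 0 + s *\<^sub>R x)) {x. f x \<le> ereal c} =
      emeasure lborel {x. f x \<le> 1}"
    by (subst emeasure_distr) (auto simp: vimage_def iff)
  finally show ?thesis by (simp add: sn)
qed

lemma exp_ereal_uminus_eq_nn_integral:
  assumes "r \<ge> 0"
  shows "exp_ereal (- r) =
    (\<integral>\<^sup>+t. ennreal (exp (- t)) * indicator {t. 0 \<le> t \<and> r \<le> ereal t} t \<partial>lborel)"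
proof (cases r)
  case (real a)
  have "(\<integral>\<^sup>+t. ennreal (exp (- t)) * indicator {a..} t \<partial>lborel) = ennreal (0 - (- exp (- a)))"
  proof (rule nn_integral_FTC_atLeast)
    show "((\<lambda>t::real. - exp (- t)) \<longlongrightarrow> 0) at_top"
      using tendsto_minus[OF filterlim_compose[OF exp_at_bot filterlim_uminus_at_bot_at_top]]
      by simp
  qed (auto intro!: derivative_eq_intros)
  moreover have "{t. 0 \<le> t \<and> r \<le> ereal t} = {a..}"
    using assms by (auto simp: real)
  ultimately show ?thesis by (simp add: real)
\<comment> \<open>For \<open>r = \<infinity>\<close> no real \<open>t\<close> contributes, in
  agreement with \<open>exp_ereal MInfty = 0\<close>.\<close>
qed (use assms exp_ereal.simps(3) in \<open>auto simp del: exp_ereal.simps\<close>)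

lemma nn_integral_exp_pos_homogeneous:
  fixes f :: "'a::euclidean_space \<Rightarrow> ereal"
  assumes f [measurable]: "f \<in> borel_measurable borel" and hom: "pos_homogeneous q f"
    and nonneg: "\<And>x. f x \<ge> 0" and q: "q > 0"
  shows "(\<integral>\<^sup>+x. exp_ereal (- f x) \<partial>lborel) =
    ennreal (Gamma (1 + real DIM('a) / q)) * emeasure lborel {x. f x \<le> 1}"
proof -
  define p where "p = real DIM('a) / q"
  have p: "p > 0" using q by (simp add: p_def)
  let ?h = "\<lambda>t x. ennreal (exp (- t)) * indicator {t. 0 \<le> t \<and> f x \<le> ereal t} t"
  let ?V = "emeasure lborel {x. f x \<le> 1}"
  have meas: "case_prod ?h \<in> borel_measurable (lborel \<Otimes>\<^sub>M lborel)"
    unfolding indicator_def by measurable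
  \<comment> \<open>The exponent \<open>1 + p - 1\<close> is the shape of Euler's integral for
    \<open>Gamma (1 + p)\<close>. The point \<open>t = 0\<close> is left out, since the scaling law
    covers positive levels only; it is a null set in the outer integral.\<close>
  have slice: "(\<integral>\<^sup>+x. ?h t x \<partial>lborel) = ennreal (indicator {0..} t * t powr (1 + p - 1) / exp t) * ?V"
    if "t \<noteq> 0" for t
  proof (cases "t > 0")
    case True
    have "(\<integral>\<^sup>+x. ?h t x \<partial>lborel) = (\<integral>\<^sup>+x. ennreal (exp (- t)) * indicator {x. f x \<le> ereal t} x \<partial>lborel)"
      using True by (intro nn_integral_cong) (auto simp: indicator_def)
    also have "\<dots> = ennreal (exp (- t)) * emeasure lborel {x. f x \<le> ereal t}"
      by (subst nn_integral_cmult_indicator) auto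
    also have "\<dots> = ennreal (exp (- t) * t powr p) * ?V"
      using emeasure_sublevel_pos_homogeneous[OF f hom q True]
      by (simp add: p_def ennreal_mult mult.assoc)
    finally show ?thesis using True by (simp add: exp_minus field_simps)
  qed (use that in auto)
  have "(\<integral>\<^sup>+x. exp_ereal (- f x) \<partial>lborel) = (\<integral>\<^sup>+x. (\<integral>\<^sup>+t. ?h t x \<partial>lborel) \<partial>lborel)"
    by (simp add: exp_ereal_uminus_eq_nn_integral[OF nonneg])
  also have "\<dots> = (\<integral>\<^sup>+t. (\<integral>\<^sup>+x. ?h t x \<partial>lborel) \<partial>lborel)"
    by (rule lborel_pair.Fubini'[OF meas])
  also have "\<dots> = (\<integral>\<^sup>+t. ennreal (indicator {0..} t * t powr (1 + p - 1) / exp t) * ?V \<partial>lborel)"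
    by (rule nn_integral_cong_AE) (use AE_lborel_singleton[of 0] slice in \<open>auto elim!: eventually_mono\<close>)
  also have "\<dots> = ennreal (Gamma (1 + p)) * ?V"
    using p by (subst nn_integral_multc) (auto simp: Gamma_conv_nn_integral_real)
  finally show ?thesis by (simp add: p_def)
qed

theorem proposition2p8:
  fixes g :: "real ^ 'n \<Rightarrow> ereal" and d q :: real and G :: "(real ^ 'n) set"
  assumes "closed_proper_convex g"
    and "d > 1"
    and "pos_homogeneous d g"
    and "G = {x. g x \<le> ereal (1 / d)}"
    and "1 / d + 1 / q = 1"
  shows "polar G = {x. conjugate g x \<le> ereal (1 / q)}
    \<and> pos_homogeneous q (conjugate g)
    \<and> (bounded G \<longrightarrow>
        emeasure lebesgue (polar G) =
          ennreal (1 / (q powr (real CARD('n) / q) * Gamma (1 + real CARD('n) / q)))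
            * (\<integral>\<^sup>+x. exp_ereal (- conjugate g x) \<partial>lebesgue))"
proof -
  have g: "convex_ereal g" "proper_ereal g" "lower_semicontinuous g"
    using assms(1) by (auto simp: closed_proper_convex_def)
  \<comment> \<open>Lower semicontinuity enters here; the value 0 at the origin also makes the
    conjugate nonnegative. Convexity enters through the sign of \<open>g\<close>.\<close>
  have zero: "g 0 = 0"
    using pos_homogeneous_zero[OF g(2,3) assms(3)] assms(2) by simp
  have nonneg: "g x \<ge> 0" for x
    by (rule pos_homogeneous_convex_nonneg[OF g(2,1) assms(3,2) zero])
  have polar: "polar G = {x. conjugate g x \<le> ereal (1 / q)}"
    unfolding assms(4) by (rule polar_sublevel_eq[OF assms(3) nonneg assms(2,5)])
  have hom: "pos_homogeneous q (conjugate g)"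
    by (rule pos_homogeneous_conjugate[OF assms(3,2,5)])
  have "1 / d < 1" using assms(2) by simp
  hence "1 / q > 0" using assms(5) by linarith
  hence q: "q > 0" by simp
  note meas [measurable] = borel_measurable_conjugate[of g]
  define p where "p = real CARD('n) / q"
  let ?V = "emeasure lborel {x. conjugate g x \<le> 1}"
  have pos: "Gamma (1 + p) > 0" using q by (intro Gamma_real_pos) (auto simp: p_def add_pos_nonneg)
  have "emeasure lebesgue (polar G) = emeasure lborel (polar G)"
  proof -
    have "polar G \<in> sets lborel" unfolding polar by measurable
    thus ?thesis by simp
  qed
  also have "\<dots> = ennreal ((1 / q) powr p) * ?V"
    using emeasure_sublevel_pos_homogeneous[OF meas hom q, of "1 / q"] q
    by (simp add: polar p_def)
  \<comment> \<open>The Gamma factor is inserted so that, together with the volume at level 1, it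
    forms the integral of \<open>exp_ereal (- conjugate g x)\<close>.\<close>
  also have "(1 / q) powr p = 1 / (q powr p * Gamma (1 + p)) * Gamma (1 + p)"
    using pos q by (simp add: powr_divide)
  also have "ennreal \<dots> * ?V =
      ennreal (1 / (q powr p * Gamma (1 + p))) * (ennreal (Gamma (1 + p)) * ?V)"
    using pos by (subst ennreal_mult) (auto simp: mult.assoc)
  also have "ennreal (Gamma (1 + p)) * ?V = (\<integral>\<^sup>+x. exp_ereal (- conjugate g x) \<partial>lborel)"
    using nn_integral_exp_pos_homogeneous[OF meas hom conjugate_nonneg[of g, OF zero] q]
    by (simp add: p_def)
  finally show ?thesis
    using polar hom by (simp add: p_def nn_integral_completion)
qed

end
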